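(* Let $(X,p)$ be a multiplicative metric space. Define $d_p : X\times X\to[0,+\infty)$ by $d_p(x,y)=\ln(p(x,y))$. Then $(X,d_p)$ is a metric space.
   Context: A multiplicative metric space is a pair $(X,p)$ where $X$ is a nonempty set and $p:X\times X\to[1,+\infty)$ is a function such that for all $x,y,z\in X$: (1) $p(x,y)\ge 1$, and $x=y$ if and only if $p(x,y)=1$; (2) $p(x,y)=p(y,x)$; (3) $p(x,z)\le p(x,y)\,p(y,z)$. *)

theory Defs
  imports "HOL-Analysis.Abstract_Metric_Spaces"
begin

locale Multiplicative_metric_space =
  fixes X :: "'a set" and p :: "'a \<Rightarrow> 'a \<Rightarrow> real"
  assumes nonempty: "X \<noteq> {}"
    and ge_one: "\<And>x y. \<lbrakk>x \<in> X; y \<in> X\<rbrakk> \<Longrightarrow> 1 \<le> p x y"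
    and eq_iff_one: "\<And>x y. \<lbrakk>x \<in> X; y \<in> X\<rbrakk> \<Longrightarrow> x = y \<longleftrightarrow> p x y = 1"
    and commute: "\<And>x y. \<lbrakk>x \<in> X; y \<in> X\<rbrakk> \<Longrightarrow> p x y = p y x"
    and mult_triangle:
      "\<And>x y z. \<lbrakk>x \<in> X; y \<in> X; z \<in> X\<rbrakk> \<Longrightarrow> p x z \<le> p x y * p y z"

text \<open>
  The function of interest is \<open>ln (p x y)\<close> on \<open>X \<times> X\<close>. The locale \<^locale>\<open>Metric_space\<close>
  demands nonnegativity and symmetry of the distance on the whole type, whereas nothing is
  assumed about \<open>p\<close> outside \<open>X\<close>; hence the arbitrary extension by 0.
\<close>

definition log_dist :: "'a set \<Rightarrow> ('a \<Rightarrow> 'a \<Rightarrow> real) \<Rightarrow> 'a \<Rightarrow> 'a \<Rightarrow> real"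
  where "log_dist X p x y = (if x \<in> X \<and> y \<in> X then ln (p x y) else 0)"

end

theory Submission
  imports Defs
begin

text \<open>
  The logarithm is an isomorphism from the ordered group of positive reals under multiplication
  onto the ordered group of reals under addition. It sends \<open>1\<close> to \<open>0\<close>, so each
  multiplicative axiom becomes the corresponding metric axiom; the values of \<open>p\<close> on \<open>X\<close>
  are at least \<open>1\<close>, so they lie in the domain of the isomorphism.
\<close>

theorem theorem3:
  fixes X :: "'a set" and p :: "'a \<Rightarrow> 'a \<Rightarrow> real"
  assumes "Multiplicative_metric_space X p"
  shows "Metric_space X (log_dist X p)"
proof -
  interpret Multiplicative_metric_space X p by (rule assms)
  have pos: "0 < p x y" if "x \<in> X" "y \<in> X" for x y
    using ge_one[OF that] by linarith
  show ?thesis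
  proof
    fix x y
    show "0 \<le> log_dist X p x y"
      by (simp add: log_dist_def ge_one)
    show "log_dist X p x y = log_dist X p y x"
      by (simp add: log_dist_def commute)
  next
    fix x y assume xy: "x \<in> X" "y \<in> X"
    show "log_dist X p x y = 0 \<longleftrightarrow> x = y"
      using xy pos[OF xy] eq_iff_one[OF xy] by (simp add: log_dist_def)
  next
    fix x y z assume x: "x \<in> X" and y: "y \<in> X" and z: "z \<in> X"
    have "ln (p x z) \<le> ln (p x y * p y z)"
      using mult_triangle[OF x y z] pos[OF x z] by simp
    also have "\<dots> = ln (p x y) + ln (p y z)"
      using pos[OF x y] pos[OF y z] by (simp add: ln_mult)
    finally show "log_dist X p x z \<le> log_dist X p x y + log_dist X p y z"
      by (simp add: log_dist_def x y z)
  qed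
qed

end
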